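(* Let $z_0\in\mathbb{C}$ and let $f$ be a non-constant complex-valued function holomorphic on an open neighbourhood of $z_0$ with $f(z_0)=z_0$ and $f'(z_0)=0$. Let $p:=\min\{n\in\mathbb{N}:f^{(n)}(z_0)\neq0\}\geq2$, and let $U$ be an open neighbourhood of $z_0$ with $f(U)\subset U$, $V\subset\mathbb{D}$ an open neighbourhood of $0$, and $\varphi:U\to V$ a conformal map with $\varphi(f^n(z))=(\varphi(z))^{p^n}$ for all $z\in U$ and $n\in\mathbb{N}$. For $\delta>0$ with $U_\delta[0]\subset V$ put $B_\delta:=\varphi^{-1}(U_\delta[0])$. Then for each $\delta>0$ with $U_\delta[0]\subset V$, comeager many functions $g\in H(\mathbb{C}\setminus\{z_0\})$ have the property that $g$ is $C(K)$-universal for $C_f$ for comeager many $K\in\mathcal{K}(B_\delta)$.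
   Context: $\mathbb{N}=\{1,2,\dots\}$; $f^n$ is the $n$-th iterate of $f$ and $f^{(n)}$ its $n$-th derivative. $\mathbb{D}$ is the open unit disc, $U_\delta[0]=\{z\in\mathbb{C}:|z|\leq\delta\}$. A conformal map is a bijective holomorphic map. (Such $U$, $V$, $\varphi$ exist by Böttcher's theorem; one has $\varphi(z_0)=0$.) $\mathcal{K}(B_\delta)$ is the set of all non-empty compact subsets of $B_\delta$, endowed with the Hausdorff distance; it is a complete metric space. $H(\mathbb{C}\setminus\{z_0\})$ is the Fréchet space of holomorphic functions on $\mathbb{C}\setminus\{z_0\}$ with the topology of locally uniform convergence. For compact $K$, $C(K)$ is the Banach space of continuous complex-valued functions on $K$ with the uniform norm. A function $g\in H(\mathbb{C}\setminus\{z_0\})$ is called $C(K)$-universal for $C_f$ (the composition operator $g\mapsto g\circ f$) if $\{g\circ f^n|_K:n\in\mathbb{N}\}$ is dense in $C(K)$; this includes the requirement $K\subset U\setminus\{z_0\}$, so that the functions $g\circ f^n|_K$ are defined. A subset of a Baire space is comeager if it contains a dense $G_\delta$-set; "comeager many elements of a space have a property" means that the set of elements having the property is comeager. The comeager set of compact sets $K$ may depend on $g$. *)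

theory Defs
  imports "HOL-Analysis.Analysis"
begin

definition comeager_in :: "'a topology \<Rightarrow> 'a set \<Rightarrow> bool" where
  "comeager_in X S \<longleftrightarrow>
     S \<subseteq> topspace X \<and> (\<exists>G. gdelta_in X G \<and> X closure_of G = topspace X \<and> G \<subseteq> S)"


text \<open>Functions on \<open>\<Omega>\<close> are represented by total functions that are \<^const>\<open>undefined\<close> off \<open>\<Omega>\<close>,
  so that equality of elements is equality on \<open>\<Omega>\<close>.\<close>

definition hol_funs :: "complex set \<Rightarrow> (complex \<Rightarrow> complex) set" where
  "hol_funs \<Omega> = {g \<in> extensional \<Omega>. g holomorphic_on \<Omega>}"

text \<open>For open \<open>\<Omega>\<close>, locally uniform convergence is uniform convergence on the compact
  subsets of \<open>\<Omega>\<close>; see \<open>limitin_hol_topology\<close> below.\<close>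

definition hol_open :: "complex set \<Rightarrow> (complex \<Rightarrow> complex) set \<Rightarrow> bool" where
  "hol_open \<Omega> W \<longleftrightarrow> W \<subseteq> hol_funs \<Omega> \<and>
     (\<forall>g\<in>W. \<exists>C e. compact C \<and> C \<subseteq> \<Omega> \<and> e > 0 \<and>
        {h \<in> hol_funs \<Omega>. \<forall>z\<in>C. dist (h z) (g z) < e} \<subseteq> W)"

definition hol_topology :: "complex set \<Rightarrow> (complex \<Rightarrow> complex) topology" where
  "hol_topology \<Omega> = topology (hol_open \<Omega>)"

lemma istopology_hol_open: "istopology (hol_open \<Omega>)"
  unfolding istopology_def
proof (intro conjI allI impI)
  fix S T assume S: "hol_open \<Omega> S" and T: "hol_open \<Omega> T"
  show "hol_open \<Omega> (S \<inter> T)"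
    unfolding hol_open_def
  proof (intro conjI ballI)
    show "S \<inter> T \<subseteq> hol_funs \<Omega>" using S by (auto simp: hol_open_def)
    fix g assume g: "g \<in> S \<inter> T"
    obtain C e where 1: "compact C" "C \<subseteq> \<Omega>" "e > 0"
      "{h \<in> hol_funs \<Omega>. \<forall>z\<in>C. dist (h z) (g z) < e} \<subseteq> S"
      using S g unfolding hol_open_def by blast
    obtain D d where 2: "compact D" "D \<subseteq> \<Omega>" "d > 0"
      "{h \<in> hol_funs \<Omega>. \<forall>z\<in>D. dist (h z) (g z) < d} \<subseteq> T"
      using T g unfolding hol_open_def by blast
    show "\<exists>C e. compact C \<and> C \<subseteq> \<Omega> \<and> e > 0 \<and>
        {h \<in> hol_funs \<Omega>. \<forall>z\<in>C. dist (h z) (g z) < e} \<subseteq> S \<inter> T"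
      by (rule exI[of _ "C \<union> D"], rule exI[of _ "min e d"])
         (use 1 2 in \<open>auto simp: compact_Un\<close>)
  qed
next
  fix \<K> assume K: "\<forall>K\<in>\<K>. hol_open \<Omega> K"
  show "hol_open \<Omega> (\<Union>\<K>)"
    unfolding hol_open_def
  proof (intro conjI ballI)
    show "\<Union>\<K> \<subseteq> hol_funs \<Omega>" using K by (auto simp: hol_open_def)
    fix g assume "g \<in> \<Union>\<K>"
    then obtain W where W: "W \<in> \<K>" "g \<in> W" by blast
    have "hol_open \<Omega> W" using K W by blast
    then obtain C e where "compact C" "C \<subseteq> \<Omega>" "e > 0"
      and sub: "{h \<in> hol_funs \<Omega>. \<forall>z\<in>C. dist (h z) (g z) < e} \<subseteq> W"
      using W unfolding hol_open_def by blast
    moreover have "{h \<in> hol_funs \<Omega>. \<forall>z\<in>C. dist (h z) (g z) < e} \<subseteq> \<Union>\<K>"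
      using sub W(1) by (meson Union_upper order_trans)
    ultimately show "\<exists>C e. compact C \<and> C \<subseteq> \<Omega> \<and> e > 0 \<and>
        {h \<in> hol_funs \<Omega>. \<forall>z\<in>C. dist (h z) (g z) < e} \<subseteq> \<Union>\<K>"
      by (intro exI[of _ C] exI[of _ e] conjI)
  qed
qed

lemma openin_hol_topology: "openin (hol_topology \<Omega>) = hol_open \<Omega>"
  by (simp add: hol_topology_def istopology_hol_open)

lemma topspace_hol_topology [simp]: "topspace (hol_topology \<Omega>) = hol_funs \<Omega>"
proof
  have "hol_open \<Omega> (hol_funs \<Omega>)"
    unfolding hol_open_def
    by (auto intro!: exI[of _ "{}"] exI[of _ "1::real"])
  then show "hol_funs \<Omega> \<subseteq> topspace (hol_topology \<Omega>)"
    by (metis openin_hol_topology openin_subset)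
  show "topspace (hol_topology \<Omega>) \<subseteq> hol_funs \<Omega>"
    by (metis openin_hol_topology hol_open_def openin_topspace)
qed

lemma limitin_hol_topology:
  "limitin (hol_topology \<Omega>) G g F \<longleftrightarrow>
     g \<in> hol_funs \<Omega> \<and> (\<forall>\<^sub>F n in F. G n \<in> hol_funs \<Omega>) \<and>
     (\<forall>C. compact C \<and> C \<subseteq> \<Omega> \<longrightarrow> uniform_limit C G g F)"
  (is "?L \<longleftrightarrow> ?R")
proof
  assume L: ?L
  then have g: "g \<in> hol_funs \<Omega>"
    by (simp add: limitin_def)
  have "\<forall>\<^sub>F n in F. G n \<in> hol_funs \<Omega>"
    using L by (metis limitin_def openin_topspace topspace_hol_topology)
  moreover have "uniform_limit C G g F" if C: "compact C" "C \<subseteq> \<Omega>" for C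
    unfolding uniform_limit_iff
  proof (intro allI impI)
    fix e :: real assume e: "e > 0"
    define W where "W = {h \<in> hol_funs \<Omega>. \<exists>d<e. \<forall>z\<in>C. dist (h z) (g z) < d}"
    have "hol_open \<Omega> W"
      unfolding hol_open_def
    proof (intro conjI ballI)
      show "W \<subseteq> hol_funs \<Omega>" by (auto simp: W_def)
      fix h assume "h \<in> W"
      then obtain d where d: "d < e" "\<forall>z\<in>C. dist (h z) (g z) < d"
        by (auto simp: W_def)
      have "k \<in> W" if k: "k \<in> hol_funs \<Omega>" "\<forall>z\<in>C. dist (k z) (h z) < (e - d) / 2" for k
      proof -
        have "\<forall>z\<in>C. dist (k z) (g z) < (e + d) / 2"
        proof
          fix z assume z: "z \<in> C"
          have "dist (k z) (g z) \<le> dist (k z) (h z) + dist (h z) (g z)"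
            by (rule dist_triangle)
          also have "\<dots> < (e - d) / 2 + d" using k d z by (intro add_strict_mono) auto
          finally show "dist (k z) (g z) < (e + d) / 2" by (simp add: field_simps)
        qed
        then show ?thesis using k d unfolding W_def
          by (intro CollectI conjI exI[of _ "(e + d) / 2"]) auto
      qed
      then show "\<exists>C e. compact C \<and> C \<subseteq> \<Omega> \<and> e > 0 \<and>
          {k \<in> hol_funs \<Omega>. \<forall>z\<in>C. dist (k z) (h z) < e} \<subseteq> W"
        using C d by (intro exI[of _ C] exI[of _ "(e - d) / 2"]) auto
    qed
    moreover have "g \<in> W"
      using g e by (auto simp: W_def intro!: exI[of _ "e / 2"])
    ultimately have "\<forall>\<^sub>F n in F. G n \<in> W"
      using L by (simp add: limitin_def openin_hol_topology)
    then show "\<forall>\<^sub>F n in F. \<forall>z\<in>C. dist (G n z) (g z) < e"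
      by (rule eventually_mono) (force simp: W_def)
  qed
  ultimately show ?R using g by blast
next
  assume R: ?R
  show ?L
    unfolding limitin_def openin_hol_topology topspace_hol_topology
  proof (intro conjI allI impI)
    show "g \<in> hol_funs \<Omega>" using R by blast
    fix W assume "hol_open \<Omega> W \<and> g \<in> W"
    then obtain C e where C: "compact C" "C \<subseteq> \<Omega>" "e > 0"
      "{h \<in> hol_funs \<Omega>. \<forall>z\<in>C. dist (h z) (g z) < e} \<subseteq> W"
      unfolding hol_open_def by blast
    then have "\<forall>\<^sub>F n in F. \<forall>z\<in>C. dist (G n z) (g z) < e"
      using R by (auto simp: uniform_limit_iff)
    moreover have "\<forall>\<^sub>F n in F. G n \<in> hol_funs \<Omega>" using R by blast
    ultimately show "\<forall>\<^sub>F n in F. G n \<in> W"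
      by eventually_elim (use C in auto)
  qed
qed


text \<open>As for \<^const>\<open>Metric_space.fdist\<close>, the value outside the intended domain is \<open>0\<close>, because
  \<^locale>\<open>Metric_space\<close> requires a nonnegative symmetric function on the whole type.\<close>

definition hausdorff_dist :: "'a::metric_space set \<Rightarrow> 'a set \<Rightarrow> real" where
  "hausdorff_dist A B =
     (if A \<noteq> {} \<and> compact A \<and> B \<noteq> {} \<and> compact B
      then max (SUP a\<in>A. infdist a B) (SUP b\<in>B. infdist b A) else 0)"

definition compact_subsets :: "'a::metric_space set \<Rightarrow> 'a set set" where
  "compact_subsets B = {K. K \<noteq> {} \<and> compact K \<and> K \<subseteq> B}"

lemma hausdorff_dist_le_iff:
  assumes "A \<noteq> {}" "compact A" "B \<noteq> {}" "compact B"
  shows "hausdorff_dist A B \<le> r \<longleftrightarrow>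
           (\<forall>a\<in>A. infdist a B \<le> r) \<and> (\<forall>b\<in>B. infdist b A \<le> r)"
proof -
  have bdd: "bdd_above ((\<lambda>x. infdist x T) ` S)" if "compact S" for S T :: "'a set"
  proof -
    have "continuous_on S (\<lambda>x. infdist x T)"
      by (rule continuous_on_infdist) (rule continuous_on_id)
    from compact_continuous_image[OF this that] show ?thesis
      by (rule bounded_imp_bdd_above[OF compact_imp_bounded])
  qed
  show ?thesis
    using assms cSUP_le_iff[OF assms(1) bdd[OF assms(2)]] cSUP_le_iff[OF assms(3) bdd[OF assms(4)]]
    by (simp add: hausdorff_dist_def)
qed

lemma Metric_space_hausdorff_dist: "Metric_space (compact_subsets B) hausdorff_dist"
proof
  fix S T :: "'a set"
  show "0 \<le> hausdorff_dist S T"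
  proof (cases "S \<noteq> {} \<and> compact S \<and> T \<noteq> {} \<and> compact T")
    case True
    then obtain s where "s \<in> S" by blast
    then have "infdist s T \<le> hausdorff_dist S T"
      using hausdorff_dist_le_iff[of S T "hausdorff_dist S T"] True by simp
    then show ?thesis
      using infdist_nonneg[of s T] by linarith
  qed (auto simp: hausdorff_dist_def)
  show "hausdorff_dist S T = hausdorff_dist T S"
    by (simp add: hausdorff_dist_def max.commute conj_ac)
next
  fix S T :: "'a set"
  assume "S \<in> compact_subsets B" "T \<in> compact_subsets B"
  then have ST: "S \<noteq> {}" "compact S" "T \<noteq> {}" "compact T"
    by (auto simp: compact_subsets_def)
  show "hausdorff_dist S T = 0 \<longleftrightarrow> S = T"
  proof
    assume "hausdorff_dist S T = 0"
    then have "(\<forall>a\<in>S. infdist a T \<le> 0) \<and> (\<forall>b\<in>T. infdist b S \<le> 0)"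
      using hausdorff_dist_le_iff[OF ST, of 0] by simp
    then have "(\<forall>a\<in>S. infdist a T = 0) \<and> (\<forall>b\<in>T. infdist b S = 0)"
      by (simp add: order_antisym infdist_nonneg)
    then show "S = T"
      using in_closed_iff_infdist_zero[of S] in_closed_iff_infdist_zero[of T] ST compact_imp_closed
      by blast
  qed (use ST in \<open>simp add: hausdorff_dist_def\<close>)
next
  fix R S T :: "'a set"
  assume "R \<in> compact_subsets B" "S \<in> compact_subsets B" "T \<in> compact_subsets B"
  then have c: "R \<noteq> {}" "compact R" "S \<noteq> {}" "compact S" "T \<noteq> {}" "compact T"
    by (auto simp: compact_subsets_def)
  have tri: "infdist x Z \<le> hausdorff_dist X Y + hausdorff_dist Y Z"
    if "x \<in> X" and XYZ: "X \<noteq> {}" "compact X" "Y \<noteq> {}" "compact Y" "Z \<noteq> {}" "compact Z"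
    for x :: 'a and X Y Z
  proof -
    have le: "infdist x Z \<le> infdist y Z + dist x y" for y by (rule infdist_triangle)
    have "continuous_on Y (dist x)"
      by (intro continuous_on_dist continuous_on_const continuous_on_id)
    then obtain y where y: "y \<in> Y" "\<forall>y'\<in>Y. dist x y \<le> dist x y'"
      using continuous_attains_inf[of Y "dist x"] XYZ by blast
    have "dist x y \<le> infdist x Y"
      unfolding infdist_notempty[OF XYZ(3)] using y XYZ(3) by (intro cINF_greatest) auto
    have "infdist x Y \<le> hausdorff_dist X Y"
      using hausdorff_dist_le_iff[of X Y "hausdorff_dist X Y"] XYZ \<open>x \<in> X\<close> by simp
    moreover have "infdist y Z \<le> hausdorff_dist Y Z"
      using hausdorff_dist_le_iff[of Y Z "hausdorff_dist Y Z"] XYZ y by simp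
    ultimately show ?thesis using le[of y] \<open>dist x y \<le> infdist x Y\<close> by linarith
  qed
  have sym: "hausdorff_dist X Y = hausdorff_dist Y X" for X Y :: "'a set"
    by (simp add: hausdorff_dist_def max.commute conj_ac)
  show "hausdorff_dist R T \<le> hausdorff_dist R S + hausdorff_dist S T"
    unfolding hausdorff_dist_le_iff[OF c(1,2,5,6)]
    using tri[of _ R S T] tri[of _ T S R] c sym[of T S] sym[of S R]
    by (metis add.commute)
qed

definition hausdorff_topology :: "'a::metric_space set \<Rightarrow> 'a set topology" where
  "hausdorff_topology B = Metric_space.mtopology (compact_subsets B) hausdorff_dist"


definition C_space :: "complex set \<Rightarrow> (complex \<Rightarrow> complex) metric" where
  "C_space K = cfunspace (top_of_set K) euclidean_metric"

text \<open>\<open>cfunspace\<close> consists of bounded continuous functions; on a compact set, boundedness is automatic.\<close>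

lemma mspace_C_space:
  assumes "compact K"
  shows "mspace (C_space K) = {h \<in> extensional K. continuous_on K h}"
proof -
  have "Met_TC.mbounded (h ` K)" if "continuous_on K h" for h :: "complex \<Rightarrow> complex"
    using compact_imp_bounded[OF compact_continuous_image[OF that assms]] by simp
  then show ?thesis
    by (auto simp: C_space_def)
qed

text \<open>In the intended use \<open>g\<close> is defined only off \<open>z\<^sub>0\<close> and the iterates of \<open>f\<close> map \<open>U - {z\<^sub>0}\<close>
  into itself, so the first conjunct says that the composites are defined on \<open>K\<close>.\<close>

definition C_universal ::
  "complex \<Rightarrow> complex set \<Rightarrow> (complex \<Rightarrow> complex) \<Rightarrow> complex set \<Rightarrow> (complex \<Rightarrow> complex) \<Rightarrow> bool" where
  "C_universal z\<^sub>0 U f K g \<longleftrightarrow>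
     K \<subseteq> U - {z\<^sub>0} \<and>
     mtopology_of (C_space K) closure_of {restrict (g \<circ> f ^^ n) K | n. n \<ge> 1} = mspace (C_space K)"

end

theory Submission
  imports Defs "HOL-Complex_Analysis.Conformal_Mappings"
begin

text \<open>
  The point is to test universality on finite sets only. Call a finite set \<open>F \<subseteq> B - {z\<^sub>0}\<close> separated
  if the moduli \<open>\<bar>\<phi> x\<bar>\<close>, \<open>x \<in> F\<close>, are pairwise distinct. In the coordinate \<open>\<phi>\<close> the iterate \<open>f\<^sup>n\<close>
  raises its argument to the power \<open>p\<^sup>n\<close>, where \<open>p \<ge> 2\<close>, so it is injective on a separated set and
  moves this set into any given neighbourhood of \<open>z\<^sub>0\<close> as \<open>n\<close> grows.

  Fix a separated \<open>F\<close>, a continuous function \<open>P\<close> and \<open>e > 0\<close>. The functions \<open>g\<close> such that some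
  \<open>g \<circ> f\<^sup>n\<close> with \<open>n \<ge> 1\<close> is \<open>e\<close>-close to \<open>P\<close> on \<open>F\<close> form an open set, because only finitely many values
  of \<open>g\<close> are involved. This set is dense (\<open>approximates_on_dense\<close>): for a given \<open>g\<close> and a compact
  \<open>C \<subseteq> - {z\<^sub>0}\<close>, choose \<open>n\<close> so large that \<open>f\<^sup>n\<close> maps \<open>F\<close> closer to \<open>z\<^sub>0\<close> than every point of \<open>C\<close>. Since
  poles at \<open>z\<^sub>0\<close> are allowed, the values at the finitely many points \<open>f\<^sup>n x\<close> can be prescribed by a
  correction that is small on \<open>C\<close> (\<open>holomorphic_interpolation_small_on_compact\<close>).

  Now let \<open>F\<close> run through a countable family \<open>\<F>\<close> of separated sets that is dense for the
  Hausdorff distance, let \<open>P\<close> run through a countable family of continuous functions that is dense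
  in every \<open>C(K)\<close> (\<open>countable_dense_in_all_C_spaces\<close>), and let \<open>e = 1/k\<close>. By the Baire property of
  the space of holomorphic functions (\<open>hol_topology_Baire\<close>), comeager many \<open>g\<close> pass all these tests.
  For each such \<open>g\<close>, the compact sets \<open>K \<subseteq> B - {z\<^sub>0}\<close> on which every \<open>P\<close> can be approximated
  uniformly by functions \<open>g \<circ> f\<^sup>n\<close> form a \<open>G\<^sub>\<delta>\<close> set, and it contains the dense family \<open>\<F>\<close>
  (\<open>comeager_universal_compact_sets\<close>).
\<close>

section \<open>A countable family of functions dense on all compact sets\<close>

text \<open>Polynomials in \<open>Re z\<close> and \<open>Im z\<close> with rational coefficients, built in stages of sums and
  products so that countability is an induction over the stages.\<close>

primrec poly_stage :: "nat \<Rightarrow> (complex \<Rightarrow> real) set" where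
  "poly_stage 0 = {Re, Im} \<union> range (\<lambda>q z. real_of_rat q)"
| "poly_stage (Suc n) = poly_stage n \<union>
     (\<lambda>(a, b) z. a z + b z) ` (poly_stage n \<times> poly_stage n) \<union>
     (\<lambda>(a, b) z. a z * b z) ` (poly_stage n \<times> poly_stage n)"

definition rat_polys :: "(complex \<Rightarrow> real) set" where
  "rat_polys = (\<Union>n. poly_stage n)"

lemma countable_rat_polys: "countable rat_polys"
proof -
  have "countable (poly_stage n)" for n
    by (induction n) auto
  then show ?thesis by (auto simp: rat_polys_def)
qed

lemma poly_stage_mono: "m \<le> n \<Longrightarrow> poly_stage m \<subseteq> poly_stage n"
  by (rule lift_Suc_mono_le) auto

lemma rat_polys_generators:
  "Re \<in> rat_polys" "Im \<in> rat_polys" "(\<lambda>z. real_of_rat q) \<in> rat_polys"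
  by (auto simp: rat_polys_def intro!: exI[of _ 0])

lemma rat_polys_closed:
  assumes "a \<in> rat_polys" "b \<in> rat_polys"
  shows "(\<lambda>z. a z + b z) \<in> rat_polys" "(\<lambda>z. a z * b z) \<in> rat_polys"
proof -
  obtain m n where mn: "a \<in> poly_stage m" "b \<in> poly_stage n"
    using assms by (auto simp: rat_polys_def)
  then have ab: "a \<in> poly_stage (max m n)" "b \<in> poly_stage (max m n)"
    using poly_stage_mono[of m "max m n"] poly_stage_mono[of n "max m n"] by auto
  then have "(\<lambda>z. a z + b z) \<in> poly_stage (Suc (max m n))"
    "(\<lambda>z. a z * b z) \<in> poly_stage (Suc (max m n))"
    by (auto intro!: rev_image_eqI[of "(a, b)"])
  then show "(\<lambda>z. a z + b z) \<in> rat_polys" "(\<lambda>z. a z * b z) \<in> rat_polys"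
    unfolding rat_polys_def by blast+
qed

lemma rat_polys_continuous:
  assumes "a \<in> rat_polys"
  shows "continuous_on S a"
proof -
  have "\<forall>a\<in>poly_stage n. continuous_on S a" for n
    by (induction n) (auto intro!: continuous_intros)
  with assms show ?thesis by (auto simp: rat_polys_def)
qed

text \<open>The uniform closure of the rational polynomials on \<open>K\<close> contains all real constants and is an
  algebra separating points, so that the Stone-Weierstrass theorem applies to it. The countable
  family itself contains only the rational constants.\<close>

lemma rat_polys_dense:
  assumes K: "compact K" and f: "continuous_on K f" and e: "e > 0"
  shows "\<exists>q\<in>rat_polys. \<forall>z\<in>K. \<bar>f z - q z\<bar> < e"
proof -
  define P where "P f \<longleftrightarrow> continuous_on K f \<and> (\<forall>e>0. \<exists>q\<in>rat_polys. \<forall>z\<in>K. \<bar>f z - q z\<bar> < e)"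
    for f :: "complex \<Rightarrow> real"
  have gen: "P q" if "q \<in> rat_polys" for q
    unfolding P_def using that by (auto intro!: bexI[of _ q] rat_polys_continuous)
  have PD: "\<exists>q\<in>rat_polys. \<forall>z\<in>K. \<bar>f z - q z\<bar> < e" if "P f" "e > 0" for f e
    using that by (simp add: P_def)
  have const: "P (\<lambda>z. c)" for c
    unfolding P_def
  proof (intro conjI allI impI)
    fix e :: real assume "e > 0"
    then obtain q where q: "c < real_of_rat q" "real_of_rat q < c + e"
      using of_rat_dense[of c "c + e"] by auto
    then show "\<exists>q\<in>rat_polys. \<forall>z\<in>K. \<bar>c - q z\<bar> < e"
      by (intro bexI[of _ "\<lambda>z. real_of_rat q"] rat_polys_generators) auto
  qed auto
  have add: "P (\<lambda>z. a z + b z)" if ab: "P a \<and> P b" for a b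
    unfolding P_def
  proof (intro conjI allI impI)
    show "continuous_on K (\<lambda>z. a z + b z)"
      using that by (auto simp: P_def intro: continuous_intros)
    fix e :: real assume "e > 0"
    then have "e / 2 > 0" by simp
    then obtain q r where qr: "q \<in> rat_polys" "r \<in> rat_polys"
      "\<forall>z\<in>K. \<bar>a z - q z\<bar> < e / 2" "\<forall>z\<in>K. \<bar>b z - r z\<bar> < e / 2"
      using ab PD[of a "e / 2"] PD[of b "e / 2"] by blast
    have "\<bar>(a z + b z) - (q z + r z)\<bar> < e" if "z \<in> K" for z
    proof -
      have "\<bar>a z - q z\<bar> < e / 2" "\<bar>b z - r z\<bar> < e / 2" using qr that by auto
      then show ?thesis by linarith
    qed
    then show "\<exists>q\<in>rat_polys. \<forall>z\<in>K. \<bar>(a z + b z) - q z\<bar> < e"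
      by (intro bexI[of _ "\<lambda>z. q z + r z"] rat_polys_closed qr) auto
  qed
  have mult: "P (\<lambda>z. a z * b z)" if ab: "P a \<and> P b" for a b
    unfolding P_def
  proof (intro conjI allI impI)
    have cont: "continuous_on K a" "continuous_on K b" using that by (auto simp: P_def)
    then show "continuous_on K (\<lambda>z. a z * b z)" by (auto intro: continuous_intros)
    have "bounded (a ` K)" "bounded (b ` K)"
      using cont K by (auto intro: compact_imp_bounded compact_continuous_image)
    then obtain M N where M: "M > 0" "\<forall>z\<in>K. \<bar>a z\<bar> \<le> M" and N: "N > 0" "\<forall>z\<in>K. \<bar>b z\<bar> \<le> N"
      unfolding bounded_pos by auto
    fix e :: real assume e: "e > 0"
    \<comment> \<open>Errors \<open>d \<le> 1\<close> in both factors change the product by less than \<open>M d + (N + 1) d\<close>.\<close>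
    define d where "d = min 1 (e / (M + N + 1))"
    have "d \<le> e / (M + N + 1)" by (simp add: d_def)
    then have d: "d * (M + N + 1) \<le> e" "d > 0" "d \<le> 1"
      using e M(1) N(1) pos_le_divide_eq[of "M + N + 1" d e] by (simp_all add: d_def)
    obtain q r where qr: "q \<in> rat_polys" "r \<in> rat_polys"
      "\<forall>z\<in>K. \<bar>a z - q z\<bar> < d" "\<forall>z\<in>K. \<bar>b z - r z\<bar> < d"
      using ab d(2) PD[of a d] PD[of b d] by blast
    have "\<bar>a z * b z - q z * r z\<bar> < e" if "z \<in> K" for z
    proof -
      have z: "\<bar>a z - q z\<bar> < d" "\<bar>b z - r z\<bar> < d" "\<bar>a z\<bar> \<le> M" "\<bar>b z\<bar> \<le> N"
        using qr M N that by auto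
      then have r: "\<bar>r z\<bar> \<le> N + 1" using d by linarith
      have "\<bar>a z * b z - q z * r z\<bar> = \<bar>a z * (b z - r z) + r z * (a z - q z)\<bar>"
        by (simp add: algebra_simps)
      also have "\<dots> \<le> \<bar>a z\<bar> * \<bar>b z - r z\<bar> + \<bar>r z\<bar> * \<bar>a z - q z\<bar>"
        by (metis abs_mult abs_triangle_ineq)
      also have "\<dots> \<le> M * \<bar>b z - r z\<bar> + (N + 1) * \<bar>a z - q z\<bar>"
        using z r by (intro add_mono mult_right_mono) auto
      also have "\<dots> < M * d + (N + 1) * d"
        using z M N by (intro add_strict_mono mult_strict_left_mono) auto
      finally show ?thesis using d(1) by (simp add: algebra_simps)
    qed
    then show "\<exists>q\<in>rat_polys. \<forall>z\<in>K. \<bar>a z * b z - q z\<bar> < e"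
      by (intro bexI[of _ "\<lambda>z. q z * r z"] rat_polys_closed qr) auto
  qed
  have "\<exists>g. P g \<and> (\<forall>x\<in>K. \<bar>f x - g x\<bar> < e / 2)"
  proof (rule Stone_Weierstrass_HOL[OF K const _ add mult])
    show "\<exists>g. P g \<and> g x \<noteq> g y" if "x \<in> K \<and> y \<in> K \<and> x \<noteq> y" for x y
      using that gen[OF rat_polys_generators(1)] gen[OF rat_polys_generators(2)] complex_eq_iff
      by blast
  qed (use f e in \<open>auto simp: P_def\<close>)
  then obtain g where "P g" and g: "\<forall>x\<in>K. \<bar>f x - g x\<bar> < e / 2" by blast
  moreover have "e / 2 > 0" using e by simp
  ultimately obtain q where q: "q \<in> rat_polys" "\<forall>z\<in>K. \<bar>g z - q z\<bar> < e / 2"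
    unfolding P_def by blast
  have "\<bar>f z - q z\<bar> < e" if "z \<in> K" for z
  proof -
    have "\<bar>f z - g z\<bar> < e / 2" "\<bar>g z - q z\<bar> < e / 2" using g q that by auto
    then show ?thesis by linarith
  qed
  then show ?thesis using q by blast
qed

text \<open>One countable family serves all compact sets at once; this is what makes the good compact sets
  for a fixed \<open>g\<close> a \<open>G\<^sub>\<delta>\<close> set.\<close>

lemma countable_dense_in_all_C_spaces:
  obtains \<P> :: "(complex \<Rightarrow> complex) set"
  where "countable \<P>" "\<P> \<noteq> {}" "\<And>P. P \<in> \<P> \<Longrightarrow> continuous_on UNIV P"
    "\<And>K h e. \<lbrakk>compact K; continuous_on K h; e > 0\<rbrakk> \<Longrightarrow> \<exists>P\<in>\<P>. \<forall>z\<in>K. dist (P z) (h z) < e"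
proof
  define \<P> where "\<P> = (\<lambda>(a, b) z. Complex (a z) (b z)) ` (rat_polys \<times> rat_polys)"
  show "countable \<P>" by (auto simp: \<P>_def countable_rat_polys)
  show "\<P> \<noteq> {}" using rat_polys_generators(1) by (auto simp: \<P>_def)
  show "continuous_on UNIV P" if "P \<in> \<P>" for P
    using that unfolding \<P>_def Complex_eq
    by (auto intro!: continuous_intros rat_polys_continuous)
  fix K and h :: "complex \<Rightarrow> complex" and e :: real
  assume K: "compact K" and h: "continuous_on K h" and "e > 0"
  then have e: "e / 2 > 0" by simp
  obtain a b where a: "a \<in> rat_polys" "\<forall>z\<in>K. \<bar>Re (h z) - a z\<bar> < e / 2"
    and b: "b \<in> rat_polys" "\<forall>z\<in>K. \<bar>Im (h z) - b z\<bar> < e / 2"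
    using rat_polys_dense[OF K continuous_on_Re[OF h] e] rat_polys_dense[OF K continuous_on_Im[OF h] e]
    by blast
  have "dist (Complex (a z) (b z)) (h z) < e" if "z \<in> K" for z
  proof -
    have "\<bar>Re (h z) - a z\<bar> < e / 2" "\<bar>Im (h z) - b z\<bar> < e / 2" using a b that by auto
    then show ?thesis
      using cmod_le[of "h z - Complex (a z) (b z)"] by (simp add: dist_norm norm_minus_commute)
  qed
  then show "\<exists>P\<in>\<P>. \<forall>z\<in>K. dist (P z) (h z) < e"
    using a b by (intro bexI[of _ "\<lambda>z. Complex (a z) (b z)"]) (auto simp: \<P>_def)
qed

section \<open>The Baire property of the space of holomorphic functions\<close>

lemma openin_hol_topology_eval:
  assumes "z \<in> \<Omega>" "open W"
  shows "openin (hol_topology \<Omega>) {g \<in> hol_funs \<Omega>. g z \<in> W}"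
  unfolding openin_hol_topology hol_open_def
proof (intro conjI ballI)
  fix g assume "g \<in> {g \<in> hol_funs \<Omega>. g z \<in> W}"
  then obtain e where "e > 0" "ball (g z) e \<subseteq> W"
    using assms by (auto simp: open_contains_ball)
  then show "\<exists>C e. compact C \<and> C \<subseteq> \<Omega> \<and> e > 0 \<and>
      {h \<in> hol_funs \<Omega>. \<forall>z\<in>C. dist (h z) (g z) < e} \<subseteq> {g \<in> hol_funs \<Omega>. g z \<in> W}"
    using assms by (intro exI[of _ "{z}"] exI[of _ e]) (auto simp: dist_commute)
qed auto

text \<open>The sets \<open>{h. \<forall>z\<in>C. dist (h z) (g z) < e}\<close> are neighbourhoods of \<open>g\<close>, and every neighbourhood of
  \<open>g\<close> contains one of them.\<close>

lemma hol_topology_dense_iff: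
  "hol_topology \<Omega> closure_of S = hol_funs \<Omega> \<longleftrightarrow>
     (\<forall>g\<in>hol_funs \<Omega>. \<forall>C e. compact C \<and> C \<subseteq> \<Omega> \<and> e > 0 \<longrightarrow>
        (\<exists>h\<in>S \<inter> hol_funs \<Omega>. \<forall>z\<in>C. dist (h z) (g z) < e))"
  (is "?L \<longleftrightarrow> ?R")
proof
  assume L: ?L
  show ?R
  proof (intro ballI allI impI)
    fix g C and e :: real assume g: "g \<in> hol_funs \<Omega>" and Ce: "compact C \<and> C \<subseteq> \<Omega> \<and> e > 0"
    \<comment> \<open>A uniform bound \<open>d < e\<close> makes openness a triangle inequality, without maxima over \<open>C\<close>.\<close>
    define W where "W = {h \<in> hol_funs \<Omega>. \<exists>d<e. \<forall>z\<in>C. dist (h z) (g z) \<le> d}"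
    have "openin (hol_topology \<Omega>) W"
      unfolding openin_hol_topology hol_open_def
    proof (intro conjI ballI)
      fix h assume "h \<in> W"
      then obtain d where d: "d < e" "\<forall>z\<in>C. dist (h z) (g z) \<le> d" by (auto simp: W_def)
      have "k \<in> W" if k: "k \<in> hol_funs \<Omega>" "\<forall>z\<in>C. dist (k z) (h z) < (e - d) / 2" for k
      proof -
        have "dist (k z) (g z) \<le> (e + d) / 2" if "z \<in> C" for z
        proof -
          have "dist (k z) (h z) < (e - d) / 2" "dist (h z) (g z) \<le> d" using k d that by auto
          then show ?thesis using dist_triangle[of "k z" "g z" "h z"] by argo
        qed
        then show ?thesis using k d unfolding W_def by (intro CollectI conjI exI[of _ "(e + d) / 2"]) auto
      qed
      then show "\<exists>C e. compact C \<and> C \<subseteq> \<Omega> \<and> e > 0 \<and>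
          {k \<in> hol_funs \<Omega>. \<forall>z\<in>C. dist (k z) (h z) < e} \<subseteq> W"
        using Ce d by (intro exI[of _ C] exI[of _ "(e - d) / 2"]) auto
    qed (auto simp: W_def)
    moreover have "g \<in> W" using g Ce by (auto simp: W_def intro!: exI[of _ 0])
    ultimately obtain h where "h \<in> S" "h \<in> W"
      using L dense_intersects_open[of "hol_topology \<Omega>" S] by auto
    then show "\<exists>h\<in>S \<inter> hol_funs \<Omega>. \<forall>z\<in>C. dist (h z) (g z) < e"
      by (auto simp: W_def intro!: bexI[of _ h])
  qed
next
  assume R: ?R
  have "S \<inter> T \<noteq> {}" if T: "hol_open \<Omega> T" "T \<noteq> {}" for T
  proof -
    obtain g where g: "g \<in> T" using T by blast
    then obtain C e where C: "compact C" "C \<subseteq> \<Omega>" "e > 0"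
      "{h \<in> hol_funs \<Omega>. \<forall>z\<in>C. dist (h z) (g z) < e} \<subseteq> T"
      using T unfolding hol_open_def by blast
    moreover have "g \<in> hol_funs \<Omega>" using g T by (auto simp: hol_open_def)
    ultimately show ?thesis using R by blast
  qed
  then show ?L
    using dense_intersects_open[of "hol_topology \<Omega>" S] by (auto simp: openin_hol_topology)
qed

text \<open>The usual nested-ball argument: functions \<open>g n\<close>, compact sets \<open>C n\<close> exhausting \<open>\<Omega>\<close> and radii \<open>e n\<close>
  are chosen such that the closed \<open>e\<close>-neighbourhoods on the \<open>C n\<close> are nested and the one with index
  \<open>n + 1\<close> lies in \<open>W n\<close>. The \<open>g n\<close> converge locally uniformly, so that the limit is holomorphic and
  belongs to all of them.\<close>

lemma hol_topology_Baire:
  assumes \<Omega>: "open \<Omega>"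
    and W_open: "\<And>n::nat. openin (hol_topology \<Omega>) (W n)"
    and W_dense: "\<And>n. hol_topology \<Omega> closure_of (W n) = hol_funs \<Omega>"
  shows "hol_topology \<Omega> closure_of (\<Inter>n. W n) = hol_funs \<Omega>"
  unfolding hol_topology_dense_iff
proof (intro ballI allI impI)
  fix g0 C0 and e0 :: real
  assume g0: "g0 \<in> hol_funs \<Omega>" and C0: "compact C0 \<and> C0 \<subseteq> \<Omega> \<and> e0 > 0"
  obtain L where L: "\<And>n::nat. compact (L n)" "\<And>n. L n \<subseteq> \<Omega>"
      "\<And>K. \<lbrakk>compact K; K \<subseteq> \<Omega>\<rbrakk> \<Longrightarrow> \<exists>N. \<forall>n\<ge>N. K \<subseteq> L n"
    using open_Union_compact_subsets[OF \<Omega>] by metis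
  define good where "good s \<longleftrightarrow> (case s of (g, C, e) \<Rightarrow> g \<in> hol_funs \<Omega> \<and> compact C \<and> C \<subseteq> \<Omega> \<and> 0 < e)"
    for s :: "(complex \<Rightarrow> complex) \<times> complex set \<times> real"
  define nxt where "nxt n s s' \<longleftrightarrow> (case s of (g, C, e) \<Rightarrow> case s' of (g', C', e') \<Rightarrow>
      C \<subseteq> C' \<and> L n \<subseteq> C' \<and> e' \<le> e / 2 \<and> (\<forall>z\<in>C. dist (g' z) (g z) < e / 2) \<and>
      {h \<in> hol_funs \<Omega>. \<forall>z\<in>C'. dist (h z) (g' z) \<le> e'} \<subseteq> W n)"
    for n and s s' :: "(complex \<Rightarrow> complex) \<times> complex set \<times> real"
  have step: "\<exists>s'. good s' \<and> nxt n s s'" if "good s" for n s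
  proof -
    obtain g C e where s: "s = (g, C, e)" by (cases s)
    have g: "g \<in> hol_funs \<Omega>" "compact C" "C \<subseteq> \<Omega>" "e > 0"
      using that by (auto simp: good_def s)
    then have "compact C \<and> C \<subseteq> \<Omega> \<and> e / 2 > 0" by simp
    then obtain g' where g': "g' \<in> W n" "\<forall>z\<in>C. dist (g' z) (g z) < e / 2"
      using W_dense[of n, unfolded hol_topology_dense_iff, rule_format, OF g(1)] by blast
    obtain D d where D: "compact D" "D \<subseteq> \<Omega>" "d > 0"
        "{h \<in> hol_funs \<Omega>. \<forall>z\<in>D. dist (h z) (g' z) < d} \<subseteq> W n"
      and g'H: "g' \<in> hol_funs \<Omega>"
      using W_open[of n] g'(1) unfolding openin_hol_topology hol_open_def by blast
    have "{h \<in> hol_funs \<Omega>. \<forall>z\<in>C \<union> D \<union> L n. dist (h z) (g' z) \<le> min (e / 2) (d / 2)}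
        \<subseteq> {h \<in> hol_funs \<Omega>. \<forall>z\<in>D. dist (h z) (g' z) < d}"
      using D(3) by force
    then have "good (g', C \<union> D \<union> L n, min (e / 2) (d / 2)) \<and>
      nxt n s (g', C \<union> D \<union> L n, min (e / 2) (d / 2))"
      using g g' D g'H L unfolding good_def nxt_def s by auto
    then show ?thesis by blast
  qed
  \<comment> \<open>The radius \<open>e0 / 2\<close> makes closed neighbourhoods suffice for the strict bound \<open>e0\<close>.\<close>
  obtain s where s0: "s 0 = (g0, C0, e0 / 2)" and s: "\<And>n. good (s n)" "\<And>n. nxt n (s n) (s (Suc n))"
  proof -
    have "\<exists>s. \<forall>n. (good (s n) \<and> (n = 0 \<longrightarrow> s n = (g0, C0, e0 / 2))) \<and> nxt n (s n) (s (Suc n))"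
    proof (rule dependent_nat_choice)
      show "\<exists>x. good x \<and> (0 = 0 \<longrightarrow> x = (g0, C0, e0 / 2))"
        using g0 C0 by (intro exI[of _ "(g0, C0, e0 / 2)"]) (simp add: good_def)
    qed (use step in auto)
    then show ?thesis using that by blast
  qed
  define g where "g n = fst (s n)" for n
  define C where "C n = fst (snd (s n))" for n
  define e where "e n = snd (snd (s n))" for n
  have s_eq: "s n = (g n, C n, e n)" for n by (simp add: g_def C_def e_def)
  have good: "g n \<in> hol_funs \<Omega>" "compact (C n)" "C n \<subseteq> \<Omega>" "e n > 0" for n
    using s(1)[of n] by (auto simp: s_eq good_def)
  have nxt: "C n \<subseteq> C (Suc n)" "L n \<subseteq> C (Suc n)" "e (Suc n) \<le> e n / 2"
      "\<And>z. z \<in> C n \<Longrightarrow> dist (g (Suc n) z) (g n z) < e n / 2"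
      "{h \<in> hol_funs \<Omega>. \<forall>z\<in>C (Suc n). dist (h z) (g (Suc n) z) \<le> e (Suc n)} \<subseteq> W n" for n
    using s(2)[of n] by (auto simp: s_eq nxt_def)
  have C_mono: "C m \<subseteq> C n" if "m \<le> n" for m n
    using that by (rule lift_Suc_mono_le[of C, OF nxt(1)])
  \<comment> \<open>Telescoping: each step costs at most \<open>e n / 2 \<le> e n - e (n + 1)\<close>.\<close>
  have tail: "dist (g (n + k) z) (g n z) \<le> e n - e (n + k)" if "z \<in> C n" for n k z
  proof (induction k)
    case (Suc k)
    have "z \<in> C (n + k)" using C_mono[of n "n + k"] that by auto
    then have "dist (g (Suc (n + k)) z) (g (n + k) z) < e (n + k) / 2" by (rule nxt(4))
    then show ?case
      using Suc nxt(3)[of "n + k"] dist_triangle[of "g (Suc (n + k)) z" "g n z" "g (n + k) z"]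
      by simp
  qed simp
  have e_small: "e n \<le> e 0 / 2 ^ n" for n
  proof (induction n)
    case (Suc n)
    have "e (Suc n) \<le> e n / 2" by (rule nxt(3))
    also have "\<dots> \<le> e 0 / 2 ^ n / 2" using Suc by simp
    finally show ?case by (simp add: mult.commute)
  qed simp
  have e_lim: "e \<longlonglongrightarrow> 0"
  proof (rule tendsto_sandwich[OF _ _ tendsto_const])
    show "(\<lambda>n. e 0 / 2 ^ n) \<longlonglongrightarrow> 0" by (rule LIMSEQ_divide_realpow_zero) auto
    show "\<forall>\<^sub>F n in sequentially. 0 \<le> e n" "\<forall>\<^sub>F n in sequentially. e n \<le> e 0 / 2 ^ n"
      using good(4) e_small by (auto simp: less_imp_le)
  qed
  have abs: "\<exists>N. z \<in> C N" if "z \<in> \<Omega>" for z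
    using L(3)[of "{z}"] that nxt(2) by force
  have tail': "dist (g m z) (g n z) \<le> e n" if "z \<in> C n" "n \<le> m" for m n z
    using tail[OF that(1), of "m - n"] that(2) good(4)[of m] by simp
  define h where "h = restrict (\<lambda>z. lim (\<lambda>n. g n z)) \<Omega>"
  have lim: "(\<lambda>n. g n z) \<longlonglongrightarrow> h z" if z: "z \<in> \<Omega>" for z
  proof -
    obtain N where N: "z \<in> C N" using abs[OF z] by blast
    have "Cauchy (\<lambda>n. g n z)"
    proof (rule metric_CauchyI)
      fix r :: real assume "r > 0"
      then have "\<forall>\<^sub>F n in sequentially. e n < r / 2"
        using order_tendstoD(2)[OF e_lim, of "r / 2"] by simp
      then obtain M where M: "\<forall>n\<ge>M. e n < r / 2" by (auto simp: eventually_sequentially)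
      define k where "k = max M N"
      have zk: "z \<in> C k" using N C_mono[of N k] by (auto simp: k_def)
      have "dist (g m z) (g n z) < r" if "m \<ge> k" "n \<ge> k" for m n
      proof -
        have "e k < r / 2" using M by (auto simp: k_def)
        then show ?thesis
          using tail'[OF zk that(1)] tail'[OF zk that(2)] dist_triangle2[of "g m z" "g n z" "g k z"]
          by linarith
      qed
      then show "\<exists>M. \<forall>m\<ge>M. \<forall>n\<ge>M. dist (g m z) (g n z) < r" by blast
    qed
    then show ?thesis
      using z by (simp add: h_def Cauchy_convergent_iff convergent_LIMSEQ_iff)
  qed
  have hclose: "dist (h z) (g n z) \<le> e n" if z: "z \<in> C n" for z n
  proof -
    have "(\<lambda>m. dist (g m z) (g n z)) \<longlonglongrightarrow> dist (h z) (g n z)"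
      using good(3) z by (intro tendsto_intros lim) auto
    then show ?thesis
      by (rule LIMSEQ_le_const2) (use tail'[OF z] in blast)
  qed
  have unif: "uniform_limit K g h sequentially" if K: "compact K" "K \<subseteq> \<Omega>" for K
  proof -
    obtain N where N: "K \<subseteq> L N" using L(3)[OF K] by auto
    have KC: "K \<subseteq> C n" if "n \<ge> Suc N" for n
      using N nxt(2)[of N] C_mono[OF that] by blast
    show ?thesis
      unfolding uniform_limit_iff
    proof (intro allI impI)
      fix r :: real assume "r > 0"
      then have "\<forall>\<^sub>F n in sequentially. e n < r" using order_tendstoD(2)[OF e_lim] by blast
      then show "\<forall>\<^sub>F n in sequentially. \<forall>z\<in>K. dist (g n z) (h z) < r"
        using eventually_ge_at_top[of "Suc N"]
      proof eventually_elim
        case (elim n)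
        then show ?case using hclose[of _ n] KC[of n] by (force simp: dist_commute)
      qed
    qed
  qed
  have "h holomorphic_on \<Omega>"
  proof (rule holomorphic_uniform_sequence[OF \<Omega>, of g])
    show "g n holomorphic_on \<Omega>" for n using good(1)[of n] by (simp add: hol_funs_def)
    show "\<exists>d. 0 < d \<and> cball x d \<subseteq> \<Omega> \<and> uniform_limit (cball x d) g h sequentially"
      if "x \<in> \<Omega>" for x
      using \<Omega> that unif by (meson compact_cball open_contains_cball)
  qed
  then have hH: "h \<in> hol_funs \<Omega>" by (simp add: hol_funs_def h_def)
  have "h \<in> W n" for n using nxt(5)[of n] hH hclose[of _ "Suc n"] by blast
  moreover have "dist (h z) (g0 z) < e0" if "z \<in> C0" for z
    using hclose[of z 0] that C0 s0 by (simp add: s_eq)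
  ultimately show "\<exists>h\<in>(\<Inter>n. W n) \<inter> hol_funs \<Omega>. \<forall>z\<in>C0. dist (h z) (g0 z) < e0"
    using hH by blast
qed

section \<open>Interpolation near the puncture\<close>

text \<open>The points of \<open>F\<close> are corrected one at a time. The correction at \<open>x\<close> is a Lagrange polynomial
  multiplied by a high power of \<open>(x - z\<^sub>0) / (z - z\<^sub>0)\<close>. This quotient is \<open>1\<close> at \<open>x\<close> and has modulus
  bounded by some \<open>q < 1\<close> on \<open>C\<close>, because \<open>x\<close> is closer to \<open>z\<^sub>0\<close> than \<open>C\<close>.\<close>

lemma holomorphic_interpolation_small_on_compact:
  assumes "finite F" "z\<^sub>0 \<notin> F" and C: "compact C" "C \<subseteq> - {z\<^sub>0}"
    and near: "\<And>x z. x \<in> F \<Longrightarrow> z \<in> C \<Longrightarrow> dist x z\<^sub>0 < dist z z\<^sub>0"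
    and g: "g \<in> hol_funs (- {z\<^sub>0})" and "e > 0"
  shows "\<exists>h\<in>hol_funs (- {z\<^sub>0}). (\<forall>x\<in>F. h x = a x) \<and> (\<forall>z\<in>C. dist (h z) (g z) < e)"
  using \<open>finite F\<close> \<open>z\<^sub>0 \<notin> F\<close> near \<open>e > 0\<close>
proof (induction F arbitrary: e)
  case empty
  then show ?case using g by (auto intro!: bexI[of _ g])
next
  case (insert x F)
  have "\<exists>h\<in>hol_funs (- {z\<^sub>0}). (\<forall>x\<in>F. h x = a x) \<and> (\<forall>z\<in>C. dist (h z) (g z) < e / 2)"
    using insert.prems by (intro insert.IH) auto
  then obtain h where h: "h \<in> hol_funs (- {z\<^sub>0})" "\<forall>x\<in>F. h x = a x"
      "\<forall>z\<in>C. dist (h z) (g z) < e / 2"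
    by blast
  define r where "r z = (x - z\<^sub>0) / (z - z\<^sub>0)" for z
  define L where "L z = (a x - h x) * (\<Prod>y\<in>F. (z - y) / (x - y))" for z
  have L: "L x = a x - h x" "\<And>y. y \<in> F \<Longrightarrow> L y = 0"
  proof -
    have "(\<Prod>y\<in>F. (x - y) / (x - y)) = (\<Prod>y\<in>F. 1)"
      using insert.hyps by (intro prod.cong) auto
    then show "L x = a x - h x" by (simp add: L_def)
    show "L y = 0" if "y \<in> F" for y
      using that insert.hyps by (auto simp: L_def)
  qed
  have "continuous_on C L" unfolding L_def divide_inverse by (intro continuous_intros)
  then have "bounded (L ` C)"
    using C by (intro compact_imp_bounded compact_continuous_image)
  then obtain M where M: "M > 0" "\<forall>z\<in>C. norm (L z) \<le> M" unfolding bounded_pos by auto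
  obtain q where q: "0 \<le> q" "q < 1" "\<forall>z\<in>C. norm (r z) \<le> q"
  proof (cases "C = {}")
    case False
    have "continuous_on C (\<lambda>z. norm (r z))"
      unfolding r_def using C by (intro continuous_intros) auto
    then obtain c where c: "c \<in> C" "\<forall>z\<in>C. norm (r z) \<le> norm (r c)"
      using continuous_attains_sup[OF C(1) False] by blast
    have "norm (r c) < 1"
      using insert.prems(2)[of x c] c(1) by (simp add: r_def dist_norm norm_divide divide_less_eq)
    then show ?thesis using c that[of "norm (r c)"] by simp
  qed (use that[of 0] in auto)
  have "0 < e / 2 / M" using insert.prems M by simp
  then obtain N where N: "q ^ N < e / 2 / M"
    using real_arch_pow_inv q(2) by blast
  define k where "k = restrict (\<lambda>z. h z + r z ^ N * L z) (- {z\<^sub>0})"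
  have hol: "(\<lambda>z. h z + r z ^ N * L z) holomorphic_on - {z\<^sub>0}"
    using h(1) unfolding r_def L_def divide_inverse
    by (auto simp: hol_funs_def intro!: holomorphic_intros)
  have "k holomorphic_on - {z\<^sub>0}"
    by (rule holomorphic_transform[OF hol]) (simp add: k_def)
  then have "k \<in> hol_funs (- {z\<^sub>0})" by (simp add: hol_funs_def k_def)
  moreover have "k y = a y" if "y \<in> insert x F" for y
  proof -
    have "y \<noteq> z\<^sub>0" "r x = 1" using that insert.prems(1) by (auto simp: r_def)
    then show ?thesis using that L h(2) by (auto simp: k_def)
  qed
  moreover have "dist (k z) (g z) < e" if z: "z \<in> C" for z
  proof -
    have "norm (r z ^ N * L z) \<le> q ^ N * M"
      unfolding norm_mult norm_power using q M z by (intro mult_mono power_mono) auto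
    also have "\<dots> < e / 2" using N M by (simp add: field_simps)
    finally have "dist (k z) (h z) < e / 2" using z C by (auto simp: k_def dist_norm)
    then show ?thesis using h(3) z dist_triangle_half_r[of "h z" "k z" e "g z"]
      by (simp add: dist_commute)
  qed
  ultimately show ?case by blast
qed

section \<open>Compact sets with the Hausdorff distance\<close>

lemma openin_hausdorff_subsets_of_open:
  assumes "open Q"
  shows "openin (hausdorff_topology B) {K \<in> compact_subsets B. K \<subseteq> Q}"
proof -
  interpret H: Metric_space "compact_subsets B" hausdorff_dist
    by (rule Metric_space_hausdorff_dist)
  have "\<exists>r>0. H.mball K r \<subseteq> {K \<in> compact_subsets B. K \<subseteq> Q}"
    if K: "K \<in> compact_subsets B" "K \<subseteq> Q" for K
  proof -
    have cK: "compact K" "K \<noteq> {}" using K by (auto simp: compact_subsets_def)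
    then obtain r where r: "r > 0" "(\<Union>x\<in>K. ball x r) \<subseteq> Q"
      using compact_subset_open_imp_ball_epsilon_subset[OF _ assms K(2)] by blast
    have "K' \<subseteq> Q" if K': "K' \<in> compact_subsets B" "hausdorff_dist K K' < r" for K'
    proof
      fix b assume b: "b \<in> K'"
      have "infdist b K \<le> hausdorff_dist K K'"
        using hausdorff_dist_le_iff[of K K' "hausdorff_dist K K'"] cK K' b
        by (auto simp: compact_subsets_def)
      then have "(INF x\<in>K. dist b x) < r"
        using K'(2) cK(2) by (simp flip: infdist_notempty)
      then obtain x where "x \<in> K" "dist b x < r"
        using cK(2) by (subst (asm) cINF_less_iff) (auto intro!: bdd_belowI2[of _ 0])
      then have "b \<in> ball x r" "x \<in> K" by (auto simp: dist_commute)
      then show "b \<in> Q" using r(2) by blast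
    qed
    then have "H.mball K r \<subseteq> {K \<in> compact_subsets B. K \<subseteq> Q}"
      unfolding H.mball_def by blast
    then show ?thesis using r(1) by blast
  qed
  then show ?thesis
    unfolding hausdorff_topology_def H.openin_mtopology by blast
qed

lemma topspace_hausdorff_topology [simp]:
  "topspace (hausdorff_topology B) = compact_subsets B"
proof -
  interpret H: Metric_space "compact_subsets B" hausdorff_dist
    by (rule Metric_space_hausdorff_dist)
  show ?thesis by (simp add: hausdorff_topology_def)
qed

text \<open>A finite net of a compact set is Hausdorff-close to it, so only finite sets have to be
  approximated.\<close>

lemma hausdorff_dense_if_approximates_finite_sets:
  assumes \<F>: "\<F> \<subseteq> compact_subsets B"
    and approx: "\<And>X e. \<lbrakk>finite X; X \<noteq> {}; X \<subseteq> B; e > 0\<rbrakk> \<Longrightarrow>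
      \<exists>F\<in>\<F>. (\<forall>x\<in>X. \<exists>y\<in>F. dist x y < e) \<and> (\<forall>y\<in>F. \<exists>x\<in>X. dist x y < e)"
  shows "hausdorff_topology B closure_of \<F> = compact_subsets B"
proof -
  interpret H: Metric_space "compact_subsets B" hausdorff_dist
    by (rule Metric_space_hausdorff_dist)
  have "\<exists>F\<in>\<F>. F \<in> H.mball K r" if K: "K \<in> compact_subsets B" and r: "r > 0" for K and r :: real
  proof -
    have cK: "compact K" "K \<noteq> {}" "K \<subseteq> B" using K by (auto simp: compact_subsets_def)
    have r3: "r / 3 > 0" using r by simp
    obtain X where X: "finite X" "X \<subseteq> K" "K \<subseteq> (\<Union>x\<in>X. ball x (r / 3))"
      using seq_compact_imp_totally_bounded[of K] cK(1) r3 compact_imp_seq_compact by meson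
    have "X \<noteq> {}" using X(3) cK(2) by auto
    then obtain F where F: "F \<in> \<F>" "\<forall>x\<in>X. \<exists>y\<in>F. dist x y < r / 3"
        "\<forall>y\<in>F. \<exists>x\<in>X. dist x y < r / 3"
      using approx[OF X(1) _ _ r3] X(2) cK(3) by (meson subset_trans)
    have cF: "compact F" "F \<noteq> {}" "F \<in> compact_subsets B"
      using F(1) \<F> by (auto simp: compact_subsets_def)
    have "hausdorff_dist K F \<le> 2 * r / 3"
      unfolding hausdorff_dist_le_iff[OF cK(2,1) cF(2,1)]
    proof (intro conjI ballI)
      fix z assume "z \<in> K"
      then obtain x where x: "x \<in> X" "dist x z < r / 3" using X(3) by auto
      then obtain y where y: "y \<in> F" "dist x y < r / 3" using F(2) by blast
      then have "dist z y \<le> 2 * r / 3" using x dist_triangle3[of z y x] by simp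
      then show "infdist z F \<le> 2 * r / 3" using y infdist_le2 by blast
    next
      fix y assume "y \<in> F"
      then obtain x where x: "x \<in> X" "dist x y < r / 3" using F(3) by blast
      then have "dist y x \<le> 2 * r / 3" using r by (simp add: dist_commute)
      then show "infdist y K \<le> 2 * r / 3" using x X(2) infdist_le2 by blast
    qed
    then show ?thesis using F(1) K cF r by (intro bexI[of _ F]) auto
  qed
  then show ?thesis
    unfolding hausdorff_topology_def H.metric_closure_of by blast
qed

text \<open>The points are perturbed one at a time, each time avoiding the finitely many values of \<open>\<nu>\<close> that
  occur already. It is applied with \<open>\<nu> = \<bar>\<phi>\<bar>\<close> and countable \<open>D\<close>, which leaves only countably many \<open>F\<close>.\<close>

lemma finite_approximation_injective:
  fixes \<nu> :: "'a::metric_space \<Rightarrow> 'b"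
  assumes D: "\<And>x e S. \<lbrakk>x \<in> B; e > 0; finite S\<rbrakk> \<Longrightarrow> \<exists>y\<in>D. dist x y < e \<and> \<nu> y \<notin> S"
    and "finite X" "X \<subseteq> B" and e: "e > 0"
  shows "\<exists>F\<subseteq>D. finite F \<and> inj_on \<nu> F \<and> (\<forall>x\<in>X. \<exists>y\<in>F. dist x y < e) \<and> (\<forall>y\<in>F. \<exists>x\<in>X. dist x y < e)"
  using \<open>finite X\<close> \<open>X \<subseteq> B\<close>
proof (induction X)
  case (insert x X)
  then obtain F where F: "F \<subseteq> D" "finite F" "inj_on \<nu> F" "\<forall>x\<in>X. \<exists>y\<in>F. dist x y < e"
      "\<forall>y\<in>F. \<exists>x\<in>X. dist x y < e"
    by auto
  then obtain y where "y \<in> D" "dist x y < e" "\<nu> y \<notin> \<nu> ` F"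
    using D[of x e "\<nu> ` F"] insert.prems e by blast
  then show ?case
    using F by (intro exI[of _ "insert y F"]) auto
qed auto

section \<open>Universality on a compact set\<close>

lemma C_universalI:
  assumes K: "compact K" "K \<subseteq> U - {z\<^sub>0}"
    and cont: "\<And>n. continuous_on K (g \<circ> f ^^ n)"
    and approx: "\<And>h e. \<lbrakk>continuous_on K h; e > 0\<rbrakk> \<Longrightarrow> \<exists>n\<ge>1. \<forall>z\<in>K. dist (h z) (g ((f ^^ n) z)) < e"
  shows "C_universal z\<^sub>0 U f K g"
proof -
  interpret C: Metric_space "mspace (C_space K)" "mdist (C_space K)"
    by (rule Metric_space_mspace_mdist)
  define S where "S = {restrict (g \<circ> f ^^ n) K | n. n \<ge> 1}"
  have "\<exists>y\<in>S. y \<in> C.mball h e" if h: "h \<in> mspace (C_space K)" and e: "e > 0" for h e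
  proof -
    have "continuous_on K h" using h by (simp add: mspace_C_space[OF K(1)])
    moreover have "e / 2 > 0" using e by simp
    ultimately obtain n where n: "n \<ge> 1" "\<forall>z\<in>K. dist (h z) (g ((f ^^ n) z)) < e / 2"
      using approx by blast
    have "mdist (C_space K) h (restrict (g \<circ> f ^^ n) K) \<le> e / 2"
      unfolding C_space_def using n(2) e by (intro mdist_cfunspace_le) (auto simp: less_imp_le)
    moreover have "restrict (g \<circ> f ^^ n) K \<in> mspace (C_space K)"
      using cont[of n] by (simp add: mspace_C_space[OF K(1)])
    ultimately show ?thesis using n(1) e h by (auto simp: S_def)
  qed
  then show ?thesis
    using K(2) unfolding C_universal_def mtopology_of_def C.metric_closure_of S_def[symmetric] by auto
qed

section \<open>Dynamics near the superattracting fixed point\<close>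

text \<open>The number \<open>p\<close> enters as the exponent in the functional equation for \<open>\<phi>\<close>; together with the
  vanishing derivative, this equation forces \<open>p \<ge> 2\<close> and \<open>\<phi> z\<^sub>0 = 0\<close>.\<close>

locale boettcher_conjugacy =
  fixes z\<^sub>0 :: complex and f \<phi> :: "complex \<Rightarrow> complex" and U V :: "complex set" and p :: nat
  assumes open_U: "open U" and z\<^sub>0_in_U: "z\<^sub>0 \<in> U"
    and holomorphic_f: "f holomorphic_on U" and f_invariant: "f ` U \<subseteq> U"
    and f_fixed: "f z\<^sub>0 = z\<^sub>0" and deriv_f: "deriv f z\<^sub>0 = 0"
    and open_V: "open V" and V_subset_disc: "V \<subseteq> ball 0 1"
    and holomorphic_\<phi>: "\<phi> holomorphic_on U" and bij_\<phi>: "bij_betw \<phi> U V"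
    and \<phi>_iterate: "\<And>z n. z \<in> U \<Longrightarrow> n \<ge> 1 \<Longrightarrow> \<phi> ((f ^^ n) z) = \<phi> z ^ (p ^ n)"
begin

lemma \<phi>_in_V: "z \<in> U \<Longrightarrow> \<phi> z \<in> V"
  using bij_\<phi> by (auto simp: bij_betw_def)

lemma norm_\<phi>_less_1: "z \<in> U \<Longrightarrow> norm (\<phi> z) < 1"
  using \<phi>_in_V V_subset_disc by fastforce

lemma \<phi>_eq_iff: "w \<in> U \<Longrightarrow> z \<in> U \<Longrightarrow> \<phi> w = \<phi> z \<longleftrightarrow> w = z"
  using bij_\<phi> by (auto simp: bij_betw_def inj_on_def)

text \<open>For \<open>p = 0\<close> the value \<open>\<phi> (f z\<^sub>0)\<close> would be \<open>1\<close>, outside the disc; for \<open>p = 1\<close> injectivity of \<open>\<phi>\<close> would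
  make \<open>f\<close> the identity, with derivative \<open>1\<close>.\<close>

lemma degree_ge_2: "p \<ge> 2"
proof -
  have fU: "f z \<in> U" and \<phi>f: "\<phi> (f z) = \<phi> z ^ p" if "z \<in> U" for z
    using that f_invariant \<phi>_iterate[of z 1] by auto
  have "p \<noteq> 0"
  proof
    assume "p = 0"
    then have "\<phi> (f z\<^sub>0) = 1" using \<phi>f[OF z\<^sub>0_in_U] by simp
    then show False using norm_\<phi>_less_1[OF fU[OF z\<^sub>0_in_U]] by simp
  qed
  moreover have "p \<noteq> 1"
  proof
    assume "p = 1"
    then have "f z = z" if "z \<in> U" for z
      using that \<phi>f fU \<phi>_eq_iff by simp
    then have "\<forall>\<^sub>F z in nhds z\<^sub>0. f z = z"
      using open_U z\<^sub>0_in_U eventually_nhds by blast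
    then have "deriv f z\<^sub>0 = deriv (\<lambda>z. z) z\<^sub>0" by (intro deriv_cong_ev) auto
    then show False using deriv_f by simp
  qed
  ultimately show ?thesis by simp
qed

lemma \<phi>_fixed_point: "\<phi> z\<^sub>0 = 0"
proof (rule ccontr)
  assume nz: "\<phi> z\<^sub>0 \<noteq> 0"
  have "norm (\<phi> z\<^sub>0) = norm (\<phi> z\<^sub>0) ^ p"
    using \<phi>_iterate[OF z\<^sub>0_in_U, of 1] f_fixed by (simp flip: norm_power)
  also have "\<dots> < norm (\<phi> z\<^sub>0) ^ 1"
    using nz degree_ge_2 norm_\<phi>_less_1[OF z\<^sub>0_in_U] by (intro power_strict_decreasing) auto
  finally show False by simp
qed

lemma \<phi>_eq_0_iff: "z \<in> U \<Longrightarrow> \<phi> z = 0 \<longleftrightarrow> z = z\<^sub>0"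
  using \<phi>_eq_iff[OF _ z\<^sub>0_in_U] \<phi>_fixed_point by simp

lemma iterate_in_U: "z \<in> U \<Longrightarrow> (f ^^ n) z \<in> U"
  using f_invariant by (induction n) auto

lemma continuous_on_iterate: "continuous_on U (f ^^ n)"
proof (induction n)
  case (Suc n)
  have "continuous_on ((f ^^ n) ` U) f"
    using holomorphic_on_imp_continuous_on[OF holomorphic_f] iterate_in_U
    by (auto intro: continuous_on_subset)
  then show ?case using continuous_on_compose[OF Suc] by simp
qed (simp add: id_def)

lemma iterate_neq:
  assumes "z \<in> U" "z \<noteq> z\<^sub>0"
  shows "(f ^^ n) z \<noteq> z\<^sub>0"
proof (cases "n = 0")
  case False
  then show ?thesis
    using assms \<phi>_iterate[of z n] \<phi>_eq_0_iff[OF assms(1)] \<phi>_fixed_point by force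
qed (use assms in simp)

text \<open>Powers are injective on the nonnegative reals, though not on the complex numbers. This is why
  the finite sets are required to have distinct moduli.\<close>

lemma iterate_inj_on:
  assumes "F \<subseteq> U" "inj_on (norm \<circ> \<phi>) F" "n \<ge> 1"
  shows "inj_on (f ^^ n) F"
proof (rule inj_onI)
  fix x y assume xy: "x \<in> F" "y \<in> F" "(f ^^ n) x = (f ^^ n) y"
  have "norm (\<phi> x) ^ (p ^ n) = norm (\<phi> y) ^ (p ^ n)"
    using \<phi>_iterate[of x n] \<phi>_iterate[of y n] xy assms by (metis norm_power subsetD)
  then have "norm (\<phi> x) = norm (\<phi> y)"
    using degree_ge_2 power_eq_imp_eq_base[of "norm (\<phi> x)" "p ^ n" "norm (\<phi> y)"] by simp
  then show "x = y" using xy assms(2) by (auto simp: inj_on_def)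
qed

lemma inverse_exists:
  obtains \<psi> where "continuous_on V \<psi>" "\<And>z. z \<in> U \<Longrightarrow> \<psi> (\<phi> z) = z" "\<And>w. w \<in> V \<Longrightarrow> \<psi> w \<in> U \<and> \<phi> (\<psi> w) = w"
proof -
  obtain \<psi> where \<psi>: "\<psi> holomorphic_on \<phi> ` U" "\<And>z. z \<in> U \<Longrightarrow> \<psi> (\<phi> z) = z"
    using holomorphic_has_inverse[OF holomorphic_\<phi> open_U bij_betw_imp_inj_on[OF bij_\<phi>]] by metis
  have V: "\<phi> ` U = V" using bij_\<phi> by (simp add: bij_betw_def)
  show ?thesis
  proof (rule that)
    show "continuous_on V \<psi>" using \<psi>(1) V by (simp add: holomorphic_on_imp_continuous_on)
    show "\<psi> w \<in> U \<and> \<phi> (\<psi> w) = w" if "w \<in> V" for w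
      using that \<psi>(2) by (auto simp flip: V)
  qed (rule \<psi>(2))
qed

lemma iterate_tendsto:
  assumes z: "z \<in> U"
  shows "(\<lambda>n. (f ^^ n) z) \<longlonglongrightarrow> z\<^sub>0"
proof -
  obtain \<psi> where \<psi>: "continuous_on V \<psi>" "\<And>z. z \<in> U \<Longrightarrow> \<psi> (\<phi> z) = z"
    using inverse_exists by metis
  have "filterlim (\<lambda>n. p ^ n) at_top sequentially"
    using degree_ge_2 by (intro filterlim_at_top_mono[OF filterlim_ident])
      (auto intro!: always_eventually less_imp_le power_gt_expt)
  then have "(\<lambda>n. \<phi> z ^ (p ^ n)) \<longlonglongrightarrow> 0"
    using filterlim_compose[OF LIMSEQ_power_zero] norm_\<phi>_less_1[OF z] by blast
  moreover have "isCont \<psi> 0"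
    using \<psi>(1) open_V \<phi>_in_V[OF z\<^sub>0_in_U] \<phi>_fixed_point by (simp add: continuous_on_eq_continuous_at)
  ultimately have "(\<lambda>n. \<psi> (\<phi> z ^ (p ^ n))) \<longlonglongrightarrow> \<psi> 0"
    by (rule isCont_tendsto_compose[rotated])
  moreover have "\<psi> 0 = z\<^sub>0" using \<psi>(2)[OF z\<^sub>0_in_U] \<phi>_fixed_point by simp
  moreover have "\<forall>\<^sub>F n in sequentially. \<psi> (\<phi> z ^ (p ^ n)) = (f ^^ n) z"
    using eventually_ge_at_top[of 1]
    by eventually_elim (metis \<phi>_iterate \<psi>(2) iterate_in_U z)
  ultimately show ?thesis by (auto dest: Lim_transform_eventually)
qed

definition approximates_on :: "complex set \<Rightarrow> (complex \<Rightarrow> complex) \<Rightarrow> real \<Rightarrow> (complex \<Rightarrow> complex) set" where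
  "approximates_on F P e =
     {g \<in> hol_funs (- {z\<^sub>0}). \<exists>n\<ge>1. \<forall>x\<in>F. dist (P x) (g ((f ^^ n) x)) < e}"

lemma openin_approximates_on:
  assumes F: "finite F" "F \<noteq> {}" "F \<subseteq> U - {z\<^sub>0}"
  shows "openin (hol_topology (- {z\<^sub>0})) (approximates_on F P e)"
proof -
  have "approximates_on F P e =
      (\<Union>n\<in>{1..}. \<Inter>x\<in>F. {g \<in> hol_funs (- {z\<^sub>0}). g ((f ^^ n) x) \<in> ball (P x) e})"
    using F(2) by (auto simp: approximates_on_def)
  also have "openin (hol_topology (- {z\<^sub>0})) \<dots>"
  proof (rule openin_Union, clarify)
    show "openin (hol_topology (- {z\<^sub>0})) (\<Inter>x\<in>F. {g \<in> hol_funs (- {z\<^sub>0}). g ((f ^^ n) x) \<in> ball (P x) e})" for n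
      using F iterate_neq by (intro openin_INT2 openin_hol_topology_eval) auto
  qed
  finally show ?thesis .
qed

lemma approximates_on_dense:
  assumes F: "finite F" "F \<subseteq> U - {z\<^sub>0}" "inj_on (norm \<circ> \<phi>) F" and e: "e > 0"
  shows "hol_topology (- {z\<^sub>0}) closure_of (approximates_on F P e) = hol_funs (- {z\<^sub>0})"
  unfolding hol_topology_dense_iff
proof (intro ballI allI impI)
  fix g C and r :: real
  assume g: "g \<in> hol_funs (- {z\<^sub>0})" and Cr: "compact C \<and> C \<subseteq> - {z\<^sub>0} \<and> r > 0"
  have "open (- C)" "z\<^sub>0 \<in> - C" using Cr compact_imp_closed by auto
  then obtain d where d: "d > 0" "ball z\<^sub>0 d \<subseteq> - C" by (auto simp: open_contains_ball)
  have "\<forall>\<^sub>F n in sequentially. \<forall>x\<in>F. dist ((f ^^ n) x) z\<^sub>0 < d"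
    using F d(1) tendstoD[OF iterate_tendsto] by (intro eventually_ball_finite) auto
  then have "\<forall>\<^sub>F n in sequentially. n \<ge> 1 \<and> (\<forall>x\<in>F. dist ((f ^^ n) x) z\<^sub>0 < d)"
    using eventually_ge_at_top by (intro eventually_conj)
  then obtain n where n: "n \<ge> 1" "\<forall>x\<in>F. dist ((f ^^ n) x) z\<^sub>0 < d"
    by (auto simp: eventually_sequentially)
  have inj: "inj_on (f ^^ n) F" using F n(1) by (intro iterate_inj_on) auto
  \<comment> \<open>Injectivity of \<open>f\<^sup>n\<close> on \<open>F\<close> makes it consistent to prescribe the value \<open>P x\<close> at each \<open>f\<^sup>n x\<close>.\<close>
  have "\<exists>h\<in>hol_funs (- {z\<^sub>0}). (\<forall>y\<in>(f ^^ n) ` F. h y = P (the_inv_into F (f ^^ n) y)) \<and>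
      (\<forall>z\<in>C. dist (h z) (g z) < r)"
  proof (rule holomorphic_interpolation_small_on_compact)
    show "z\<^sub>0 \<notin> (f ^^ n) ` F" using F(2) iterate_neq by fastforce
    show "dist y z\<^sub>0 < dist z z\<^sub>0" if "y \<in> (f ^^ n) ` F" "z \<in> C" for y z
    proof -
      have "dist y z\<^sub>0 < d" using that n(2) by auto
      moreover have "d \<le> dist z z\<^sub>0" using d(2) that(2) by (force simp: dist_commute)
      ultimately show ?thesis by simp
    qed
  qed (use F Cr g in auto)
  then obtain h where h: "h \<in> hol_funs (- {z\<^sub>0})" "\<forall>z\<in>C. dist (h z) (g z) < r"
      "\<forall>x\<in>F. h ((f ^^ n) x) = P x"
    using the_inv_into_f_f[OF inj] by auto
  then have "h \<in> approximates_on F P e"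
    using n(1) e by (auto simp: approximates_on_def)
  then show "\<exists>h\<in>approximates_on F P e \<inter> hol_funs (- {z\<^sub>0}). \<forall>z\<in>C. dist (h z) (g z) < r"
    using h by blast
qed

text \<open>In the coordinate \<open>\<phi>\<close>, move from \<open>\<phi> x\<close> radially towards \<open>0\<close>, or away from \<open>0\<close> if \<open>\<phi> x = 0\<close>. The
  modulus is strictly monotone along this path, so each element of \<open>S\<close> is attained at most once.\<close>

lemma moduli_avoidable:
  assumes \<delta>: "\<delta> > 0" "cball 0 \<delta> \<subseteq> V"
    and x: "x \<in> U" "\<phi> x \<in> cball 0 \<delta>" and e: "e > 0" and S: "finite S"
  shows "\<exists>y\<in>U. \<phi> y \<in> cball 0 \<delta> \<and> dist x y < e \<and> norm (\<phi> y) \<notin> S"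
proof -
  obtain \<psi> where \<psi>: "continuous_on V \<psi>" "\<And>z. z \<in> U \<Longrightarrow> \<psi> (\<phi> z) = z"
      "\<And>w. w \<in> V \<Longrightarrow> \<psi> w \<in> U \<and> \<phi> (\<psi> w) = w"
    using inverse_exists by metis
  define w :: "real \<Rightarrow> complex"
    where "w t = (if \<phi> x = 0 then of_real (t * \<delta>) else of_real (1 - t) * \<phi> x)" for t
  have w_lim: "(w \<longlongrightarrow> \<phi> x) (at_right 0)"
    unfolding w_def by (cases "\<phi> x = 0") (auto intro!: tendsto_eq_intros)
  have norm_w: "norm (w t) = (if \<phi> x = 0 then t * \<delta> else (1 - t) * norm (\<phi> x))" if "t \<in> {0<..<1}" for t
    using that \<delta>(1) unfolding w_def norm_mult norm_of_real if_distrib[of norm] by simp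
  have w_in: "\<forall>\<^sub>F t in at_right 0. w t \<in> cball 0 \<delta>"
    using eventually_at_right_real[OF zero_less_one]
  proof eventually_elim
    case (elim t)
    then have "norm (w t) \<le> \<delta>"
      using \<delta>(1) x(2) mult_mono[of "1 - t" 1 "norm (\<phi> x)" \<delta>] mult_mono[of t 1 \<delta> \<delta>]
      unfolding norm_w[OF elim] by simp
    then show ?case by simp
  qed
  have w_S: "\<forall>\<^sub>F t in at_right 0. \<forall>s\<in>S. norm (w t) \<noteq> s"
  proof (rule eventually_ball_finite[OF S], rule ballI)
    fix s
    \<comment> \<open>The only parameter at which the path can have modulus \<open>s\<close>.\<close>
    define t0 where "t0 = (if \<phi> x = 0 then s / \<delta> else 1 - s / norm (\<phi> x))"
    have "\<forall>\<^sub>F t in at_right 0. t \<in> {0<..<1} \<and> t \<noteq> t0"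
      by (intro eventually_conj eventually_at_right_real eventually_neq_at_within) auto
    then show "\<forall>\<^sub>F t in at_right 0. norm (w t) \<noteq> s"
    proof eventually_elim
      case (elim t)
      then have t: "t \<in> {0<..<1}" "t \<noteq> t0" by auto
      show ?case
      proof
        assume "norm (w t) = s"
        then have "t = t0"
          using \<delta>(1) unfolding norm_w[OF t(1)] t0_def by (cases "\<phi> x = 0") auto
        then show False using t by simp
      qed
    qed
  qed
  have "isCont \<psi> (\<phi> x)"
    using \<psi>(1) open_V \<phi>_in_V[OF x(1)] by (simp add: continuous_on_eq_continuous_at)
  then have "((\<lambda>t. \<psi> (w t)) \<longlongrightarrow> x) (at_right 0)"
    using isCont_tendsto_compose[OF _ w_lim] \<psi>(2)[OF x(1)] by metis
  then have "\<forall>\<^sub>F t in at_right 0. dist (\<psi> (w t)) x < e" using e by (rule tendstoD)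
  then have "\<forall>\<^sub>F t in at_right 0. w t \<in> cball 0 \<delta> \<and> norm (w t) \<notin> S \<and> dist (\<psi> (w t)) x < e"
    using w_in w_S by eventually_elim auto
  then obtain t where t: "w t \<in> cball 0 \<delta>" "norm (w t) \<notin> S" "dist (\<psi> (w t)) x < e"
    using eventually_happens'[OF trivial_limit_at_right_real] by blast
  then show ?thesis
    using \<psi>(3)[of "w t"] \<delta>(2) by (intro bexI[of _ "\<psi> (w t)"]) (auto simp: dist_commute)
qed

text \<open>The points of \<open>B\<close> whose modulus \<open>\<bar>\<phi>\<bar>\<close> avoids a finite set form a relatively open dense subset, and
  every countable dense subset of \<open>B\<close> meets it near each point.\<close>

lemma countable_set_avoiding_moduli:
  assumes \<delta>: "\<delta> > 0" "cball 0 \<delta> \<subseteq> V"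
  defines "B \<equiv> {z \<in> U. \<phi> z \<in> cball 0 \<delta>}"
  obtains D where "countable D" "D \<subseteq> B - {z\<^sub>0}"
    "\<And>x e S. \<lbrakk>x \<in> B; e > 0; finite S\<rbrakk> \<Longrightarrow> \<exists>y\<in>D. dist x y < e \<and> (norm \<circ> \<phi>) y \<notin> S"
proof -
  obtain T where T: "countable T" "T \<subseteq> B" "B \<subseteq> closure T" using separable by blast
  show thesis
  proof
    show "countable (T - {z\<^sub>0})" "T - {z\<^sub>0} \<subseteq> B - {z\<^sub>0}" using T by auto
    fix x and e :: real and S :: "real set" assume x: "x \<in> B" and e: "e > 0" and S: "finite S"
    \<comment> \<open>The modulus \<open>0\<close> is added to \<open>S\<close> in order to avoid \<open>z\<^sub>0\<close>.\<close>
    define Q where "Q = (U \<inter> (norm \<circ> \<phi>) -` (- insert 0 S)) \<inter> ball x e"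
    have "open (U \<inter> (norm \<circ> \<phi>) -` (- insert 0 S))"
      using S holomorphic_on_imp_continuous_on[OF holomorphic_\<phi>] open_U
      by (intro continuous_open_preimage) (auto simp: o_def finite_imp_closed intro!: continuous_intros)
    then have "open Q" by (auto simp: Q_def)
    moreover obtain y where "y \<in> B" "y \<in> Q"
      using moduli_avoidable[OF \<delta>, of x e "insert 0 S"] x e S by (auto simp: B_def Q_def)
    ultimately obtain y' where "y' \<in> T" "y' \<in> Q"
      using T(3) by (meson closure_iff_nhds_not_empty disjoint_iff subset_eq)
    then show "\<exists>y\<in>T - {z\<^sub>0}. dist x y < e \<and> (norm \<circ> \<phi>) y \<notin> S"
      using \<phi>_fixed_point by (intro bexI[of _ y']) (auto simp: Q_def)
  qed
qed

text \<open>Passing the tests for \<open>F\<close> says exactly that \<open>F\<close> belongs to the \<open>G\<^sub>\<delta>\<close> set \<open>G\<close> of compact sets on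
  which all \<open>P\<close> are approximated, so \<open>G\<close> is dense as soon as the family \<open>\<F>\<close> of tested sets is.\<close>

lemma comeager_universal_compact_sets:
  fixes \<P> :: "(complex \<Rightarrow> complex) set"
  assumes "B \<subseteq> U" and g: "g \<in> hol_funs (- {z\<^sub>0})"
    and \<P>: "countable \<P>" "\<P> \<noteq> {}" "\<And>P. P \<in> \<P> \<Longrightarrow> continuous_on UNIV P"
      "\<And>K h e. \<lbrakk>compact K; continuous_on K h; e > 0\<rbrakk> \<Longrightarrow> \<exists>P\<in>\<P>. \<forall>z\<in>K. dist (P z) (h z) < e"
    and \<F>: "\<F> \<subseteq> compact_subsets B" "\<And>F. F \<in> \<F> \<Longrightarrow> z\<^sub>0 \<notin> F"
      "hausdorff_topology B closure_of \<F> = compact_subsets B"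
    and approx: "\<And>F P k. F \<in> \<F> \<Longrightarrow> P \<in> \<P> \<Longrightarrow> g \<in> approximates_on F P (1 / real (Suc k))"
  shows "comeager_in (hausdorff_topology B) {K \<in> compact_subsets B. C_universal z\<^sub>0 U f K g}"
proof -
  have cont: "continuous_on (U - {z\<^sub>0}) (g \<circ> f ^^ n)" for n
  proof (rule continuous_on_compose)
    show "continuous_on (U - {z\<^sub>0}) (f ^^ n)"
      using continuous_on_iterate by (rule continuous_on_subset) auto
    show "continuous_on ((f ^^ n) ` (U - {z\<^sub>0})) g"
    proof (rule continuous_on_subset)
      show "continuous_on (- {z\<^sub>0}) g"
        using g by (simp add: hol_funs_def holomorphic_on_imp_continuous_on)
      show "(f ^^ n) ` (U - {z\<^sub>0}) \<subseteq> - {z\<^sub>0}" using iterate_neq by blast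
    qed
  qed
  define Q where "Q P k n = {z \<in> U - {z\<^sub>0}. dist (P z) (g ((f ^^ n) z)) < 1 / real (Suc k)}" for P k n
  have open_Q: "open (Q P k n)" if "P \<in> \<P>" for P k n
  proof -
    have "open ((U - {z\<^sub>0}) \<inter> (\<lambda>z. dist (P z) ((g \<circ> f ^^ n) z)) -` {..<1 / real (Suc k)})"
    proof (intro continuous_open_preimage continuous_on_dist)
      show "continuous_on (U - {z\<^sub>0}) P"
        using \<P>(3)[OF that] by (rule continuous_on_subset) simp
      show "continuous_on (U - {z\<^sub>0}) (g \<circ> f ^^ n)" by (rule cont)
    qed (use open_U in auto)
    also have "\<dots> = Q P k n" unfolding Q_def comp_def by blast
    finally show ?thesis .
  qed
  define A where "A P k = (\<Union>n\<in>{1..}. {K \<in> compact_subsets B. K \<subseteq> Q P k n})" for P k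
  define G where "G = (\<Inter>(P, k)\<in>\<P> \<times> UNIV. A P k)"
  have open_A: "openin (hausdorff_topology B) (A P k)" if "P \<in> \<P>" for P k
    unfolding A_def
    by (rule openin_Union) (use openin_hausdorff_subsets_of_open[OF open_Q[OF that]] in blast)
  have "gdelta_in (hausdorff_topology B) G"
    unfolding G_def
  proof (rule gdelta_in_Inter)
    show "countable ((\<lambda>(P, k). A P k) ` (\<P> \<times> UNIV))" using \<P>(1) by simp
    show "gdelta_in (hausdorff_topology B) S" if "S \<in> (\<lambda>(P, k). A P k) ` (\<P> \<times> UNIV)" for S
      using that open_A open_imp_gdelta_in by force
  qed (use \<P>(2) in simp)
  moreover have "hausdorff_topology B closure_of G = topspace (hausdorff_topology B)"
  proof -
    have "F \<in> A P k" if F: "F \<in> \<F>" and P: "P \<in> \<P>" for F P k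
    proof -
      obtain n where "n \<ge> 1" "\<forall>z\<in>F. dist (P z) (g ((f ^^ n) z)) < 1 / real (Suc k)"
        using approx[OF F P, of k] unfolding approximates_on_def by blast
      moreover have "F \<in> compact_subsets B" "F \<subseteq> U - {z\<^sub>0}"
        using F \<F>(1,2) \<open>B \<subseteq> U\<close> by (auto simp: compact_subsets_def)
      ultimately show ?thesis unfolding A_def Q_def by blast
    qed
    then have "\<F> \<subseteq> G" by (auto simp: G_def)
    then show ?thesis
      using closure_of_mono[of \<F> G "hausdorff_topology B"] \<F>(3)
        closure_of_subset_topspace[of "hausdorff_topology B" G] by auto
  qed
  moreover have "C_universal z\<^sub>0 U f K g" if K: "K \<in> G" for K
  proof (rule C_universalI)
    have KQ: "\<exists>n\<ge>1. K \<subseteq> Q P k n" if "P \<in> \<P>" for P k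
    proof -
      have "K \<in> A P k" using K that by (auto simp: G_def)
      then show ?thesis by (auto simp: A_def)
    qed
    obtain P0 where "P0 \<in> \<P>" using \<P>(2) by blast
    then show "compact K" and KU: "K \<subseteq> U - {z\<^sub>0}"
      using K KQ[of P0 0] by (auto simp: G_def A_def compact_subsets_def Q_def)
    show "continuous_on K (g \<circ> f ^^ n)" for n
      using cont KU by (rule continuous_on_subset)
    fix h :: "complex \<Rightarrow> complex" and e :: real assume h: "continuous_on K h" and "e > 0"
    then have e: "e / 2 > 0" by simp
    obtain P where P: "P \<in> \<P>" "\<forall>z\<in>K. dist (P z) (h z) < e / 2"
      using \<P>(4)[OF \<open>compact K\<close> h e] by blast
    obtain k where k: "1 / real (Suc k) < e / 2" using nat_approx_posE[OF e] by blast
    obtain n where n: "n \<ge> 1" "K \<subseteq> Q P k n" using KQ[OF P(1)] by blast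
    have "dist (h z) (g ((f ^^ n) z)) < e" if "z \<in> K" for z
    proof -
      have "dist (P z) (h z) < e / 2" "dist (P z) (g ((f ^^ n) z)) < e / 2"
        using P(2) n(2) that k unfolding Q_def by (blast intro: less_trans)+
      then show ?thesis by (rule dist_triangle_half_r)
    qed
    then show "\<exists>n\<ge>1. \<forall>z\<in>K. dist (h z) (g ((f ^^ n) z)) < e" using n(1) by blast
  qed
  moreover have "G \<subseteq> compact_subsets B"
    using \<P>(2) by (auto simp: G_def A_def)
  ultimately show ?thesis
    unfolding comeager_in_def by (intro conjI exI[of _ G]) auto
qed

end

section \<open>Comeager many universal functions\<close>

theorem theorem3p5:
  fixes z\<^sub>0 :: complex and f \<phi> :: "complex \<Rightarrow> complex" and D U V :: "complex set"
    and p :: nat and \<delta> :: real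
  assumes "open D" "z\<^sub>0 \<in> D" "f holomorphic_on D" "\<not> f constant_on D"
    and "f z\<^sub>0 = z\<^sub>0" "deriv f z\<^sub>0 = 0"
    and "p = (LEAST n. n \<ge> 1 \<and> (deriv ^^ n) f z\<^sub>0 \<noteq> 0)"
    and "open U" "z\<^sub>0 \<in> U" "U \<subseteq> D" "f ` U \<subseteq> U"
    and "open V" "0 \<in> V" "V \<subseteq> ball 0 1"
    and "\<phi> holomorphic_on U" "bij_betw \<phi> U V"
    and "\<And>z n. z \<in> U \<Longrightarrow> n \<ge> 1 \<Longrightarrow> \<phi> ((f ^^ n) z) = \<phi> z ^ (p ^ n)"
    and "\<delta> > 0" "cball 0 \<delta> \<subseteq> V"
  defines "B \<equiv> {z \<in> U. \<phi> z \<in> cball 0 \<delta>}"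
  shows "comeager_in (hol_topology (- {z\<^sub>0}))
           {g \<in> hol_funs (- {z\<^sub>0}).
              comeager_in (hausdorff_topology B)
                {K \<in> compact_subsets B. C_universal z\<^sub>0 U f K g}}"
proof -
  interpret boettcher_conjugacy z\<^sub>0 f \<phi> U V p
    using assms(3,10) by unfold_locales (rule assms holomorphic_on_subset | assumption)+
  obtain \<P> :: "(complex \<Rightarrow> complex) set" where \<P>: "countable \<P>" "\<P> \<noteq> {}" "\<And>P. P \<in> \<P> \<Longrightarrow> continuous_on UNIV P"
      "\<And>K h e. \<lbrakk>compact K; continuous_on K h; e > 0\<rbrakk> \<Longrightarrow> \<exists>P\<in>\<P>. \<forall>z\<in>K. dist (P z) (h z) < e"
    using countable_dense_in_all_C_spaces by blast
  obtain E where E: "countable E" "E \<subseteq> B - {z\<^sub>0}"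
      "\<And>x e S. \<lbrakk>x \<in> B; e > 0; finite S\<rbrakk> \<Longrightarrow> \<exists>y\<in>E. dist x y < e \<and> (norm \<circ> \<phi>) y \<notin> S"
    using countable_set_avoiding_moduli[OF \<open>\<delta> > 0\<close> \<open>cball 0 \<delta> \<subseteq> V\<close>, folded B_def] by blast
  define \<F> where "\<F> = {F. F \<subseteq> E \<and> finite F \<and> F \<noteq> {} \<and> inj_on (norm \<circ> \<phi>) F}"
  have "countable \<F>"
    using countable_Collect_finite_subset[OF E(1)] by (rule countable_subset[rotated]) (auto simp: \<F>_def)
  have \<F>_sub: "\<F> \<subseteq> compact_subsets B"
    using E(2) by (auto simp: \<F>_def compact_subsets_def finite_imp_compact)
  have \<F>_dense: "hausdorff_topology B closure_of \<F> = compact_subsets B"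
  proof (rule hausdorff_dense_if_approximates_finite_sets[OF \<F>_sub])
    fix X and e :: real assume X: "finite X" "X \<noteq> {}" "X \<subseteq> B" and e: "e > 0"
    obtain F where "F \<subseteq> E" "finite F" "inj_on (norm \<circ> \<phi>) F"
        "\<forall>x\<in>X. \<exists>y\<in>F. dist x y < e" "\<forall>y\<in>F. \<exists>x\<in>X. dist x y < e"
      using finite_approximation_injective[OF E(3) X(1,3) e] by blast
    moreover from this have "F \<noteq> {}" using X(2) by blast
    ultimately show "\<exists>F\<in>\<F>. (\<forall>x\<in>X. \<exists>y\<in>F. dist x y < e) \<and> (\<forall>y\<in>F. \<exists>x\<in>X. dist x y < e)"
      by (auto simp: \<F>_def)
  qed
  define I where "I = \<F> \<times> \<P> \<times> (UNIV :: nat set)"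
  define W where "W = (\<lambda>(F, P, k). approximates_on F P (1 / real (Suc k)))"
  have "\<F> \<noteq> {}"
  proof -
    obtain y where "y \<in> E" using E(3)[of z\<^sub>0 1 "{}"] \<phi>_fixed_point z\<^sub>0_in_U \<open>\<delta> > 0\<close> by (auto simp: B_def)
    then have "{y} \<in> \<F>" by (auto simp: \<F>_def)
    then show ?thesis by blast
  qed
  then have I: "countable I" "I \<noteq> {}"
    using \<open>countable \<F>\<close> \<P>(1,2) by (auto simp: I_def)
  have \<F>_D: "finite F" "F \<noteq> {}" "F \<subseteq> U - {z\<^sub>0}" "inj_on (norm \<circ> \<phi>) F" if "F \<in> \<F>" for F
    using that E(2) by (auto simp: \<F>_def B_def)
  have W_open: "openin (hol_topology (- {z\<^sub>0})) (W i)" if "i \<in> I" for i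
    using that openin_approximates_on[OF \<F>_D(1-3)] by (auto simp: I_def W_def)
  have W_dense: "hol_topology (- {z\<^sub>0}) closure_of (W i) = hol_funs (- {z\<^sub>0})" if "i \<in> I" for i
    using that approximates_on_dense[OF \<F>_D(1,3,4)] by (auto simp: I_def W_def)
  define G where "G = (\<Inter>i\<in>I. W i)"
  have "gdelta_in (hol_topology (- {z\<^sub>0})) G"
    unfolding G_def using I W_open by (intro gdelta_in_Inter) (auto intro: open_imp_gdelta_in)
  moreover have "hol_topology (- {z\<^sub>0}) closure_of G = hol_funs (- {z\<^sub>0})"
  proof -
    have "W ` I = W ` range (from_nat_into I)" by (simp add: range_from_nat_into[OF I(2,1)])
    then have "G = (\<Inter>n. W (from_nat_into I n))" by (simp add: G_def image_image)
    then show ?thesis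
      using hol_topology_Baire[of "- {z\<^sub>0}" "\<lambda>n. W (from_nat_into I n)"] W_open W_dense
        from_nat_into[OF I(2)] by (simp add: open_Compl)
  qed
  moreover have "comeager_in (hausdorff_topology B) {K \<in> compact_subsets B. C_universal z\<^sub>0 U f K g}"
    if g: "g \<in> G" for g
  proof (rule comeager_universal_compact_sets[OF _ _ \<P> \<F>_sub _ \<F>_dense])
    show approx: "g \<in> approximates_on F P (1 / real (Suc k))" if "F \<in> \<F>" "P \<in> \<P>" for F P k
      using g that by (auto simp: G_def I_def W_def)
    show "g \<in> hol_funs (- {z\<^sub>0})"
      using approx \<open>\<F> \<noteq> {}\<close> \<P>(2) by (auto simp: approximates_on_def)
  qed (use \<F>_D in \<open>auto simp: B_def\<close>)
  moreover have "G \<subseteq> hol_funs (- {z\<^sub>0})"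
    using I(2) by (auto simp: G_def W_def approximates_on_def)
  ultimately show ?thesis
    unfolding comeager_in_def[of "hol_topology _"] by (intro conjI exI[of _ G]) auto
qed

end
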